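(* Let $G$ be a torsion-free abelian group of finite rank and suppose that $H$ is a nonzero indecomposable fully invariant direct summand of $G$. Then $H$ appears as a summand in any indecomposable decomposition of $G$; that is, if $G=G_1\oplus\cdots\oplus G_t$ with all $G_i$ indecomposable, then $H=G_i$ for some $i$.
   Context: An indecomposable decomposition of $G$ is a direct decomposition $G=G_1\oplus\cdots\oplus G_t$ with each $G_i$ nonzero and indecomposable. A subgroup of $G$ is fully invariant if it is mapped into itself by every endomorphism of $G$. *)

theory Defs
  imports "HOL-Algebra.Product_Groups" "HOL-Algebra.FiniteProduct"
begin

text \<open>Abelian groups are the multiplicatively written \<^const>\<open>comm_group\<close> structures:
  sum, zero and integer multiples \<open>n x\<close> are the group product, \<open>\<one>\<close> and the
  power \<open>x [^] n\<close>. Subgroups are carrier sets; a subgroup \<open>H\<close> considered as a group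
  is \<open>G\<lparr>carrier := H\<rparr>\<close>.\<close>

definition torsion_free :: "('a, 'b) monoid_scheme \<Rightarrow> bool" where
  "torsion_free G \<longleftrightarrow>
     (\<forall>x\<in>carrier G. \<forall>n::nat. n > 0 \<longrightarrow> x [^]\<^bsub>G\<^esub> n = \<one>\<^bsub>G\<^esub> \<longrightarrow> x = \<one>\<^bsub>G\<^esub>)"

definition int_independent :: "('a, 'b) monoid_scheme \<Rightarrow> 'a set \<Rightarrow> bool" where
  "int_independent G S \<longleftrightarrow> S \<subseteq> carrier G \<and>
     (\<forall>A (c :: 'a \<Rightarrow> int). finite A \<longrightarrow> A \<subseteq> S \<longrightarrow>
        finprod G (\<lambda>x. x [^]\<^bsub>G\<^esub> c x) A = \<one>\<^bsub>G\<^esub> \<longrightarrow> (\<forall>x\<in>A. c x = 0))"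

text \<open>The rank of a torsion-free abelian group is the cardinality of a maximal
  independent subset.\<close>

definition finite_rank :: "('a, 'b) monoid_scheme \<Rightarrow> bool" where
  "finite_rank G \<longleftrightarrow>
     (\<exists>S. finite S \<and> int_independent G S \<and> (\<forall>T. int_independent G T \<longrightarrow> S \<subseteq> T \<longrightarrow> T = S))"

definition direct_sum2 :: "('a, 'b) monoid_scheme \<Rightarrow> 'a set \<Rightarrow> 'a set \<Rightarrow> bool" where
  "direct_sum2 G A B \<longleftrightarrow>
     subgroup A G \<and> subgroup B G \<and> A <#>\<^bsub>G\<^esub> B = carrier G \<and> A \<inter> B = {\<one>\<^bsub>G\<^esub>}"

definition direct_summand :: "'a set \<Rightarrow> ('a, 'b) monoid_scheme \<Rightarrow> bool" where
  "direct_summand H G \<longleftrightarrow> (\<exists>K. direct_sum2 G H K)"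

text \<open>The trivial group satisfies this predicate; nonzeroness is always stated separately.\<close>

definition indecomposable :: "('a, 'b) monoid_scheme \<Rightarrow> bool" where
  "indecomposable G \<longleftrightarrow>
     (\<forall>A B. direct_sum2 G A B \<longrightarrow> A = {\<one>\<^bsub>G\<^esub>} \<or> B = {\<one>\<^bsub>G\<^esub>})"

definition fully_invariant :: "'a set \<Rightarrow> ('a, 'b) monoid_scheme \<Rightarrow> bool" where
  "fully_invariant H G \<longleftrightarrow> subgroup H G \<and> (\<forall>f\<in>hom G G. f ` H \<subseteq> H)"

text \<open>Internal direct sum of the subgroups \<open>K 1, \<dots>, K t\<close>: the summation map from
  their external direct sum to \<open>G\<close> is an isomorphism.\<close>

definition direct_decomposition ::
    "('a, 'b) monoid_scheme \<Rightarrow> nat \<Rightarrow> (nat \<Rightarrow> 'a set) \<Rightarrow> bool" where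
  "direct_decomposition G t K \<longleftrightarrow>
     (\<forall>i\<in>{1..t}. subgroup (K i) G) \<and>
     (\<lambda>x. finprod G x {1..t}) \<in> iso (sum_group {1..t} (\<lambda>i. G\<lparr>carrier := K i\<rparr>)) G"

definition indecomposable_decomposition ::
    "('a, 'b) monoid_scheme \<Rightarrow> nat \<Rightarrow> (nat \<Rightarrow> 'a set) \<Rightarrow> bool" where
  "indecomposable_decomposition G t K \<longleftrightarrow>
     direct_decomposition G t K \<and>
     (\<forall>i\<in>{1..t}. K i \<noteq> {\<one>\<^bsub>G\<^esub>} \<and> indecomposable (G\<lparr>carrier := K i\<rparr>))"

end

theory Submission
  imports Defs
begin

text \<open>Let \<open>p\<close> be the projection of \<open>G\<close> onto one of the \<open>G\<^sub>i\<close> with \<open>p(H) \<noteq> 0\<close>. Full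
  invariance makes \<open>p\<close> an idempotent endomorphism of \<open>H\<close>, so \<open>H = p(H) \<oplus> (H \<inter> ker p)\<close>, and
  indecomposability of \<open>H\<close> gives \<open>H = p(H) \<subseteq> G\<^sub>i\<close>. A complement \<open>L\<close> of \<open>H\<close> in \<open>G\<close> then yields
  \<open>G\<^sub>i = H \<oplus> (G\<^sub>i \<inter> L)\<close> by the modular law, and indecomposability of \<open>G\<^sub>i\<close> gives \<open>H = G\<^sub>i\<close>.\<close>

text \<open>The projections are the coordinates of the inverse of the summation isomorphism, read as
  endomorphisms of \<open>G\<close>. The last property, joint injectivity, is what later supplies an
  index whose projection does not kill \<open>H\<close>.\<close>

lemma direct_decomposition_projections:
  fixes G (structure)
  assumes "comm_group G" and "direct_decomposition G t K"
  obtains p where "\<And>i. i \<in> {1..t} \<Longrightarrow> p i \<in> hom G G"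
    and "\<And>i x. i \<in> {1..t} \<Longrightarrow> x \<in> carrier G \<Longrightarrow> p i x \<in> K i"
    and "\<And>i x. i \<in> {1..t} \<Longrightarrow> x \<in> K i \<Longrightarrow> p i x = x"
    and "\<And>x. x \<in> carrier G \<Longrightarrow> (\<And>i. i \<in> {1..t} \<Longrightarrow> p i x = \<one>) \<Longrightarrow> x = \<one>"
proof -
  interpret comm_group G by (fact assms(1))
  define S where "S = sum_group {1..t} (\<lambda>i. G\<lparr>carrier := K i\<rparr>)"
  define \<phi> where "\<phi> = (\<lambda>x. finprod G x {1..t})"
  have sub: "subgroup (K i) G" if "i \<in> {1..t}" for i
    using assms(2) that by (auto simp: direct_decomposition_def)
  have grp: "group (G\<lparr>carrier := K i\<rparr>)" if "i \<in> {1..t}" for i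
    using sub[OF that] subgroup_imp_group by blast
  have S: "group S"
    unfolding S_def by (rule sum_group) (use grp in auto)
  have iso: "\<phi> \<in> iso S G"
    using assms(2) by (simp add: direct_decomposition_def S_def \<phi>_def)
  have carrier_S: "carrier S = (\<Pi>\<^sub>E i\<in>{1..t}. K i)"
    unfolding S_def by (subst carrier_sum_group) (use grp in auto)
  have mult_S: "(x \<otimes>\<^bsub>S\<^esub> y) i = x i \<otimes> y i" if "i \<in> {1..t}" for x y i
    using that by (simp add: S_def)
  \<comment> \<open>\<open>\<psi>\<close> sends an element of \<open>G\<close> to its family of
    components. Being again an isomorphism, it makes each coordinate a homomorphism.\<close>
  define \<psi> where "\<psi> = inv_into (carrier S) \<phi>"
  have \<psi>: "\<psi> \<in> iso G S"
    unfolding \<psi>_def by (rule group.iso_set_sym[OF S iso])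
  have \<psi>_S: "\<psi> x \<in> carrier S" if "x \<in> carrier G" for x
    using \<psi> that by (auto simp: iso_def hom_def)
  have \<phi>\<psi>: "\<phi> (\<psi> x) = x" if "x \<in> carrier G" for x
    using iso that by (simp add: \<psi>_def iso_def bij_betw_def f_inv_into_f)
  have \<psi>\<phi>: "\<psi> (\<phi> f) = f" if "f \<in> carrier S" for f
    using iso that by (simp add: \<psi>_def iso_def bij_betw_def)
  have mem: "\<psi> x i \<in> K i" if "i \<in> {1..t}" "x \<in> carrier G" for i x
    using \<psi>_S[OF that(2)] that(1) by (auto simp: carrier_S)
  show ?thesis
  proof (rule that[of "\<lambda>i x. \<psi> x i"])
    fix i assume i: "i \<in> {1..t}"
    show "(\<lambda>x. \<psi> x i) \<in> hom G G"
    proof (rule homI)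
      fix x y assume "x \<in> carrier G" "y \<in> carrier G"
      then show "\<psi> (x \<otimes> y) i = \<psi> x i \<otimes> \<psi> y i"
        using \<psi> i by (simp add: iso_def hom_def mult_S)
    qed (use mem[OF i] subgroup.subset[OF sub[OF i]] in auto)
  next
    fix i x assume i: "i \<in> {1..t}" and x: "x \<in> K i"
    \<comment> \<open>The family with \<open>x\<close> in slot \<open>i\<close> and the identity
      elsewhere sums to \<open>x\<close>, so by injectivity of \<open>\<phi>\<close> it is the
      component family of \<open>x\<close>. The \<open>restrict\<close> is there because elements of
      the external sum are extensional functions on the index set.\<close>
    define f where "f = restrict (\<lambda>j. if i = j then x else \<one>) {1..t}"
    have f: "f \<in> carrier S"
      using x sub by (auto simp: f_def carrier_S subgroup.one_closed)
    have xG: "x \<in> carrier G" using subgroup.subset[OF sub[OF i]] x by auto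
    have "\<phi> f = finprod G (\<lambda>j. if i = j then x else \<one>) {1..t}"
      unfolding \<phi>_def by (rule finprod_cong) (use xG in \<open>auto simp: f_def simp_implies_def\<close>)
    also have "\<dots> = x"
      by (rule finprod_singleton[OF i, of "\<lambda>_. x"]) (use xG in auto)
    finally have "\<psi> x = f" using \<psi>\<phi>[OF f] by simp
    then show "\<psi> x i = x" using i by (simp add: f_def)
  next
    fix x assume x: "x \<in> carrier G" and triv: "\<And>i. i \<in> {1..t} \<Longrightarrow> \<psi> x i = \<one>"
    \<comment> \<open>An element is the product of its components, so it is trivial once they all
      are.\<close>
    have "x = finprod G (\<psi> x) {1..t}" using \<phi>\<psi>[OF x] by (simp add: \<phi>_def)
    also have "\<dots> = \<one>" by (rule finprod_one_eqI) (use triv in auto)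
    finally show "x = \<one>" .
  qed (use mem in auto)
qed

lemma direct_sum2_subgroupI:
  fixes G (structure)
  assumes "group G" and "subgroup H G" and "subgroup A G" and "subgroup B G"
    and "A \<subseteq> H" and "B \<subseteq> H" and "A \<inter> B = {\<one>}"
    and "\<And>x. x \<in> H \<Longrightarrow> \<exists>a\<in>A. \<exists>b\<in>B. x = a \<otimes> b"
  shows "direct_sum2 (G\<lparr>carrier := H\<rparr>) A B"
proof -
  interpret group G by (fact assms(1))
  have "A <#>\<^bsub>G\<lparr>carrier := H\<rparr>\<^esub> B = H"
  proof
    show "A <#>\<^bsub>G\<lparr>carrier := H\<rparr>\<^esub> B \<subseteq> H"
      using assms(5,6) subgroup.m_closed[OF assms(2)] by (auto simp: set_mult_def)
    show "H \<subseteq> A <#>\<^bsub>G\<lparr>carrier := H\<rparr>\<^esub> B"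
      using assms(8) by (fastforce simp: set_mult_def)
  qed
  then show ?thesis
    using assms by (simp add: direct_sum2_def subgroup_incl)
qed

lemma direct_sum2_trivial:
  fixes G (structure)
  assumes "group G" and "direct_sum2 G A {\<one>}"
  shows "A = carrier G"
proof -
  interpret group G by (fact assms(1))
  have "A \<subseteq> carrier G" and "A <#> {\<one>} = carrier G"
    using assms(2) by (auto simp: direct_sum2_def dest: subgroup.subset)
  moreover from this have "A <#> {\<one>} = A" by (force simp: set_mult_def)
  ultimately show ?thesis by simp
qed

text \<open>This is the modular law: if an element of \<open>H\<close> is written as
  \<open>a \<otimes> b\<close>, then \<open>a\<close> lies in \<open>H\<close> because
  \<open>A\<close> does, hence so does \<open>b\<close>.\<close>

lemma direct_sum2_restrict:
  fixes G (structure)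
  assumes "group G" and "direct_sum2 G A B" and "subgroup H G" and "A \<subseteq> H"
  shows "direct_sum2 (G\<lparr>carrier := H\<rparr>) A (H \<inter> B)"
proof -
  interpret group G by (fact assms(1))
  have A: "subgroup A G" and B: "subgroup B G" and AB: "A <#> B = carrier G" "A \<inter> B = {\<one>}"
    using assms(2) by (auto simp: direct_sum2_def)
  show ?thesis
  proof (rule direct_sum2_subgroupI[OF assms(1,3) A _ assms(4)])
    show "subgroup (H \<inter> B) G" using assms(3) B by (rule subgroups_Inter_pair)
    show "A \<inter> (H \<inter> B) = {\<one>}" using AB assms(4) by auto
    fix x assume x: "x \<in> H"
    then have "x \<in> carrier G" using subgroup.subset[OF assms(3)] by auto
    then obtain a b where ab: "a \<in> A" "b \<in> B" "x = a \<otimes> b"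
      unfolding AB(1)[symmetric] set_mult_def by auto
    have G: "a \<in> carrier G" "b \<in> carrier G"
      using ab subgroup.subset[OF A] subgroup.subset[OF B] by auto
    have "b = inv a \<otimes> x"
      using G by (simp add: ab(3) inv_solve_left)
    then have "b \<in> H"
      using x ab(1) assms(3,4) by (auto intro: subgroup.m_closed subgroup.m_inv_closed)
    then show "\<exists>a\<in>A. \<exists>b\<in>H \<inter> B. x = a \<otimes> b" using ab by auto
  qed auto
qed

text \<open>This is the splitting x = p(x) + (x - p(x)) in multiplicative notation. Idempotence is
  required only on \<open>H\<close>, so the kernel of \<open>p\<close> in \<open>G\<close> is cut
  down to \<open>H\<close>.\<close>

lemma direct_sum2_idempotent:
  fixes G (structure)
  assumes "group G" and "subgroup H G" and "p \<in> hom G G" and "p ` H \<subseteq> H"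
    and "\<And>x. x \<in> H \<Longrightarrow> p (p x) = p x"
  shows "direct_sum2 (G\<lparr>carrier := H\<rparr>) (p ` H) (H \<inter> kernel G G p)"
proof -
  interpret group G by (fact assms(1))
  interpret p: group_hom G G p
    using assms(1,3) by (simp add: group_hom_def group_hom_axioms_def)
  have HG: "x \<in> carrier G" if "x \<in> H" for x
    using subgroup.subset[OF assms(2)] that by auto
  show ?thesis
  proof (rule direct_sum2_subgroupI[OF assms(1,2)])
    show "subgroup (p ` H) G" by (rule p.subgroup_img_is_subgroup[OF assms(2)])
    show "subgroup (H \<inter> kernel G G p) G"
      using assms(2) p.subgroup_kernel by (rule subgroups_Inter_pair)
    have "\<one> \<in> p ` H"
      using p.hom_one subgroup.one_closed[OF assms(2)] by (metis imageI)
    \<comment> \<open>If \<open>p y\<close> with \<open>y\<close> in \<open>H\<close> lies in the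
      kernel, then \<open>p y = p (p y) = \<one>\<close>.\<close>
    then show "p ` H \<inter> (H \<inter> kernel G G p) = {\<one>}"
      using assms(5) subgroup.one_closed[OF assms(2)] by (auto simp: kernel_def)
    fix x assume x: "x \<in> H"
    have px: "p x \<in> H" using assms(4) x by auto
    have "inv p x \<otimes> x \<in> H"
      using assms(2) x px by (auto intro: subgroup.m_closed subgroup.m_inv_closed)
    moreover have "p (inv p x \<otimes> x) = \<one>"
      using x px HG assms(5)[OF x] by simp
    ultimately have "inv p x \<otimes> x \<in> H \<inter> kernel G G p"
      using HG by (auto simp: kernel_def)
    moreover have "x = p x \<otimes> (inv p x \<otimes> x)"
      using x px HG by (simp add: m_assoc[symmetric])
    ultimately show "\<exists>a\<in>p ` H. \<exists>b\<in>H \<inter> kernel G G p. x = a \<otimes> b"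
      using x by blast
  qed (use assms(4) in auto)
qed

theorem lemma4p2:
  fixes G :: "('a, 'b) monoid_scheme"
    and H :: "'a set"
    and t :: nat
    and K :: "nat \<Rightarrow> 'a set"
  assumes "comm_group G"
    and "torsion_free G"
    and "finite_rank G"
    and "H \<noteq> {\<one>\<^bsub>G\<^esub>}"
    and "indecomposable (G\<lparr>carrier := H\<rparr>)"
    and "fully_invariant H G"
    and "direct_summand H G"
    and "indecomposable_decomposition G t K"
  shows "\<exists>i\<in>{1..t}. H = K i"
proof -
  interpret comm_group G by (fact assms(1))
  have H: "subgroup H G" and inv: "\<And>f. f \<in> hom G G \<Longrightarrow> f ` H \<subseteq> H"
    using assms(6) by (auto simp: fully_invariant_def)
  have HG: "H \<subseteq> carrier G" by (rule subgroup.subset[OF H])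
  have dec: "direct_decomposition G t K"
    and indec: "\<And>i. i \<in> {1..t} \<Longrightarrow> indecomposable (G\<lparr>carrier := K i\<rparr>)"
    using assms(8) by (auto simp: indecomposable_decomposition_def)
  obtain p where p: "\<And>i. i \<in> {1..t} \<Longrightarrow> p i \<in> hom G G"
      "\<And>i x. i \<in> {1..t} \<Longrightarrow> x \<in> carrier G \<Longrightarrow> p i x \<in> K i"
      "\<And>i x. i \<in> {1..t} \<Longrightarrow> x \<in> K i \<Longrightarrow> p i x = x"
      "\<And>x. x \<in> carrier G \<Longrightarrow> (\<And>i. i \<in> {1..t} \<Longrightarrow> p i x = \<one>\<^bsub>G\<^esub>) \<Longrightarrow> x = \<one>\<^bsub>G\<^esub>"
    using direct_decomposition_projections[OF assms(1) dec] by blast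
  obtain h where h: "h \<in> H" "h \<noteq> \<one>\<^bsub>G\<^esub>"
    using assms(4) subgroup.one_closed[OF H] by auto
  \<comment> \<open>If every projection killed \<open>h\<close>, joint injectivity would make
    \<open>h\<close> trivial.\<close>
  then obtain i where i: "i \<in> {1..t}" "p i h \<noteq> \<one>\<^bsub>G\<^esub>"
    using p(4) HG by blast
  have Ki: "subgroup (K i) G"
    using dec i(1) by (auto simp: direct_decomposition_def)
  \<comment> \<open>\<open>p i\<close> is idempotent because it maps \<open>G\<close> into
    \<open>K i\<close> and fixes \<open>K i\<close> pointwise; full invariance keeps the image of
    \<open>H\<close> inside \<open>H\<close>.\<close>
  have sum: "direct_sum2 (G\<lparr>carrier := H\<rparr>) (p i ` H) (H \<inter> kernel G G (p i))"
    by (rule direct_sum2_idempotent) (use H inv p i HG in auto)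
  have "p i ` H \<noteq> {\<one>\<^bsub>G\<^esub>}" using h i(2) by auto
  with sum have ker: "H \<inter> kernel G G (p i) = {\<one>\<^bsub>G\<^esub>}"
    using assms(5) by (fastforce simp: indecomposable_def)
  \<comment> \<open>With the kernel part trivial, the image is the only remaining summand of
    \<open>H\<close>, so it is all of \<open>H\<close>.\<close>
  have "p i ` H = H"
    using direct_sum2_trivial[of "G\<lparr>carrier := H\<rparr>" "p i ` H"] sum ker subgroup_imp_group[OF H]
    by simp
  then have "H \<subseteq> K i" using p(2)[OF i(1)] HG by (metis image_subset_iff subsetD)
  obtain L where "direct_sum2 G H L"
    using assms(7) by (auto simp: direct_summand_def)
  then have L: "direct_sum2 (G\<lparr>carrier := K i\<rparr>) H (K i \<inter> L)"
    using direct_sum2_restrict Ki \<open>H \<subseteq> K i\<close> by blast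
  \<comment> \<open>Here \<open>H\<close> is the nontrivial summand, so indecomposability of
    \<open>K i\<close> must kill the other one.\<close>
  then have "K i \<inter> L = {\<one>\<^bsub>G\<^esub>}"
    using indec[OF i(1)] assms(4) by (fastforce simp: indecomposable_def)
  then have "H = K i"
    using direct_sum2_trivial[of "G\<lparr>carrier := K i\<rparr>" H] L subgroup_imp_group[OF Ki] by simp
  then show ?thesis using i(1) by auto
qed

end
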